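(* Assume (A1)-(A7) (listed in the context). Suppose there exists a function $\phi:\mathbb{R}^d\to[0,\infty)$ with $\phi(\theta)\to\infty$ as $\|\theta\|\to\infty$ such that, outside the unit ball of $\mathbb{R}^d$: (S1) $\phi$ is twice differentiable and all its second order derivatives are bounded by some constant $c$; (S2) for every $\theta$ and every compact $K\subset\mathbb{R}^k$, $\langle\nabla\phi(\theta),f(\theta,y)\rangle\le0$ for all $y\in K$. Then for step-size sequences of the form $a(n)=\frac{1}{n(\log n)^p}$, $n\ge2$, with $0<p\le1$, one has $$\liminf_{n\to\infty}E[\phi(\theta_n)]<\infty.$$
   Context: Recursion. Consider the $\mathbb{R}^d$-valued stochastic approximation iterates $\theta_{n+1}=\theta_n+a(n)[f(\theta_n,Y_n)+M_{n+1}]$, where $\{Y_n\}$ is an $\mathbb{R}^k$-valued Markov iterate-dependent noise, i.e. $P[Y_{n+1}\in A\mid\mathcal F_n]=\int_A \Pi_{\theta_n}(Y_n;dx)$ a.s. for all $n$ and Borel $A$, with $\Pi_\theta$ a transition kernel for each $\theta$; $\mathcal F_n$ is the $\sigma$-field generated by all random variables realized till time $n$; and $\{M_n\}$ is a martingale difference sequence with respect to $\{\mathcal F_n\}$. For a function $\psi$ write $\Pi_\theta\psi(x)=\int\Pi_\theta(x;dy)\psi(y)$. Assumptions. (A1) There is $\bar C>0$ with $\limsup_{n\to\infty}\|Y_n\|<\bar C$ a.s. (A2) There is a constant $K_0>0$ with $\sup_y\|f(\theta,y)\|\le K_0(1+\|\theta\|)$ for all $\theta$. (A3) The step sizes $a(n)$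 are non-increasing positive scalars with $\sum_n a(n)=\infty$, $\sum_n a(n)^2<\infty$. (A4) For every $\theta$ the Markov kernel $\Pi_\theta$ has a unique invariant probability $\Gamma_\theta$, and $h(\theta)=\int f(\theta,y)\Gamma_\theta(dy)$ is Lipschitz with constant $0<L<\infty$. (A5) $\|M_{n+1}\|\le K'(1+\|\theta_n\|)$ a.s. for all $n$. (A6) For every $\theta$ the Poisson equation $(1-\Pi_\theta)v_\theta=f(\theta,\cdot)-\int f(\theta,y)\Gamma_\theta(dy)$ has a solution $v_\theta$. (A7) For all $R>0$ there is a constant $C_R>0$ such that (a) $\sup_{\|\theta\|\le R}\|v_\theta(x)\|\le C_R(1+\|x\|)$ and (b) $\|v_\theta(x)-v_{\theta'}(x)\|\le C_R\|\theta-\theta'\|(1+\|x\|)$ whenever $\|\theta\|\le R$, $\|\theta'\|\le R$.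
   Formalization: Added: E‖θ_0‖² < ∞ (else f=0, M=0, φ=|θ|², θ_0 Cauchy is a counterexample), φ bounded on the closed unit ball (else φ may blow up at the limit of the iterates), and φ Borel measurable, so that E[φ(θ_n)] is defined. *)

theory Defs
  imports "HOL-Probability.Probability"
begin

(* The noise M has no term at time 0: it enters the recursion through M 1, M 2, ... *)
definition history ::
  "'w measure \<Rightarrow> (nat \<Rightarrow> 'w \<Rightarrow> real ^ 'd) \<Rightarrow> (nat \<Rightarrow> 'w \<Rightarrow> real ^ 'k) \<Rightarrow>
   (nat \<Rightarrow> 'w \<Rightarrow> real ^ 'd) \<Rightarrow> nat \<Rightarrow> 'w measure" where
  "history P \<theta> Y M n = sigma (space P)
     ({\<theta> m -` A \<inter> space P | m A. m \<le> n \<and> A \<in> sets borel} \<union>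
      {Y m -` B \<inter> space P | m B. m \<le> n \<and> B \<in> sets borel} \<union>
      {M m -` A \<inter> space P | m A. 1 \<le> m \<and> m \<le> n \<and> A \<in> sets borel})"

(* The library's conditional expectation is real-valued; for vectors it is taken componentwise. *)
definition martingale_difference ::
  "'w measure \<Rightarrow> (nat \<Rightarrow> 'w measure) \<Rightarrow> (nat \<Rightarrow> 'w \<Rightarrow> real ^ 'd) \<Rightarrow> bool" where
  "martingale_difference P F M \<longleftrightarrow>
     (\<forall>n. M (Suc n) \<in> borel_measurable (F (Suc n)) \<and> integrable P (M (Suc n)) \<and>
          (\<forall>i. AE \<omega> in P. real_cond_exp P (F n) (\<lambda>\<omega>. M (Suc n) \<omega> $ i) \<omega> = 0))"

definition transition_kernel :: "(real ^ 'k \<Rightarrow> (real ^ 'k) measure) \<Rightarrow> bool" where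
  "transition_kernel \<kappa> \<longleftrightarrow> \<kappa> \<in> borel \<rightarrow>\<^sub>M prob_algebra borel"

(* Conditional law of the next state, given the history, when the kernel itself depends on
   the current iterate. *)
definition iterate_dependent_markov ::
  "'w measure \<Rightarrow> (nat \<Rightarrow> 'w measure) \<Rightarrow> (real ^ 'd \<Rightarrow> real ^ 'k \<Rightarrow> (real ^ 'k) measure) \<Rightarrow>
   (nat \<Rightarrow> 'w \<Rightarrow> real ^ 'd) \<Rightarrow> (nat \<Rightarrow> 'w \<Rightarrow> real ^ 'k) \<Rightarrow> bool" where
  "iterate_dependent_markov P F \<kappa> \<theta> Y \<longleftrightarrow>
     (\<forall>n. \<forall>A\<in>sets borel. AE \<omega> in P.
        real_cond_exp P (F n) (indicator (Y (Suc n) -` A \<inter> space P)) \<omega>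
          = measure (\<kappa> (\<theta> n \<omega>) (Y n \<omega>)) A)"

definition invariant_prob ::
  "(real ^ 'k \<Rightarrow> (real ^ 'k) measure) \<Rightarrow> (real ^ 'k) measure \<Rightarrow> bool" where
  "invariant_prob \<kappa> \<mu> \<longleftrightarrow> \<mu> \<in> space (prob_algebra borel) \<and> \<mu> \<bind> \<kappa> = \<mu>"

end

(* By (S2), applied to singletons, phi decreases along f everywhere outside the unit ball, so no
   averaging of the Markov noise is needed. Inside the ball nothing is known about phi; it is
   replaced by psi = huber (phi - B), where B bounds phi on the ball of radius 4. Then psi vanishes
   there, phi - psi is bounded, and for small steps psi satisfies a second order descent inequality
   with a direction w that is a nonnegative multiple of the gradient of phi. The f-part of w is
   nonpositive and the martingale part has mean zero, so E psi(theta_n) grows by at most a constant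
   times a(n)^2 E (1 + |theta_n|)^2. Discrete Gronwall bounds the last expectation by a multiple of
   exp (2 K (a(0) + ... + a(n-1))) = n^o(1), hence the increments are summable. In particular
   E phi(theta_n) is eventually bounded. *)
theory Submission
  imports Defs "HOL-Real_Asymp.Real_Asymp"
begin

section \<open>Mean value estimates along a segment\<close>

text \<open>Mean value inequality, with the operator norm of a matrix bounded by the number of its
  entries times the entry bound \<open>c\<close>. The hypotheses are confined to one segment because
  the exterior of the ball is not convex.\<close>

lemma bounded_hessian_imp_gradient_lipschitz:
  fixes \<phi>' :: "real ^ 'd \<Rightarrow> real ^ 'd" and \<phi>'' :: "real ^ 'd \<Rightarrow> real ^ 'd ^ 'd"
  assumes "\<And>t. t \<in> closed_segment x y \<Longrightarrow> (\<phi>' has_derivative (\<lambda>h. \<phi>'' t *v h)) (at t)"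
    and "\<And>t i j. t \<in> closed_segment x y \<Longrightarrow> \<bar>\<phi>'' t $ i $ j\<bar> \<le> c"
  shows "norm (\<phi>' y - \<phi>' x) \<le> (real CARD('d))\<^sup>2 * c * norm (y - x)"
proof (rule differentiable_bound[where S = "closed_segment x y" and f' = "\<lambda>t h. \<phi>'' t *v h"])
  fix t assume t: "t \<in> closed_segment x y"
  show "(\<phi>' has_derivative (\<lambda>h. \<phi>'' t *v h)) (at t within closed_segment x y)"
    using assms(1)[OF t] by (rule has_derivative_at_withinI)
  show "onorm (\<lambda>h. \<phi>'' t *v h) \<le> (real CARD('d))\<^sup>2 * c"
    using onorm_le_matrix_component[of "\<phi>'' t" c] assms(2)[OF t] by (simp add: power2_eq_square)
qed auto

text \<open>The mean value inequality is applied to \<phi> minus its linearization at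
  \<open>x\<close>. Compared with Taylor's formula this loses a factor 1/2, which only affects
  constants.\<close>

lemma gradient_lipschitz_imp_quadratic_remainder:
  fixes \<phi> :: "'a::real_inner \<Rightarrow> real"
  assumes deriv: "\<And>t. t \<in> closed_segment x y \<Longrightarrow> GDERIV \<phi> t :> \<phi>' t"
    and lip: "\<And>t. t \<in> closed_segment x y \<Longrightarrow> norm (\<phi>' t - \<phi>' x) \<le> D * norm (t - x)"
    and "0 \<le> D"
  shows "\<bar>\<phi> y - \<phi> x - \<phi>' x \<bullet> (y - x)\<bar> \<le> D * (norm (y - x))\<^sup>2"
proof -
  define g where "g t = \<phi> t - \<phi>' x \<bullet> t" for t
  have "norm (g y - g x) \<le> D * norm (y - x) * norm (y - x)"
  proof (rule differentiable_bound[where S = "closed_segment x y" and f' = "\<lambda>t h. (\<phi>' t - \<phi>' x) \<bullet> h"])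
    fix t assume t: "t \<in> closed_segment x y"
    have "(\<phi> has_derivative (\<lambda>h. \<phi>' t \<bullet> h)) (at t within closed_segment x y)"
      using deriv[OF t] unfolding gderiv_def
      by (auto intro: has_derivative_at_withinI simp: inner_commute)
    then show "(g has_derivative (\<lambda>h. (\<phi>' t - \<phi>' x) \<bullet> h)) (at t within closed_segment x y)"
      unfolding g_def by (auto intro!: derivative_eq_intros simp: inner_diff_left)
    have "norm (\<phi>' t - \<phi>' x) \<le> D * norm (y - x)"
      using lip[OF t] segment_bound1[OF t] \<open>0 \<le> D\<close> 
      by (meson order_trans mult_left_mono)
    then show "onorm (\<lambda>h. (\<phi>' t - \<phi>' x) \<bullet> h) \<le> D * norm (y - x)"
      using \<open>0 \<le> D\<close>
      by (intro onorm_bound) (auto intro!: order_trans[OF Cauchy_Schwarz_ineq2] mult_right_mono)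
  qed auto
  then show ?thesis
    by (simp add: g_def power2_eq_square inner_diff_right algebra_simps)
qed

section \<open>Growth of \<phi> and its gradient outside the unit ball\<close>

lemma norm_ge_on_closed_segment:
  fixes x :: "'a::real_normed_vector"
  assumes "t \<in> closed_segment x y" shows "norm x - norm (y - x) \<le> norm t"
  using segment_bound1[OF assms] norm_triangle_ineq2[of x t] by (simp add: norm_minus_commute)

text \<open>Along this segment the norm is a convex combination of 2 and \<open>norm x\<close>, both
  larger than 1. So every exterior point is joined to the sphere of radius 2 without meeting the
  closed unit ball.\<close>

lemma radial_segment:
  fixes x :: "'a::real_normed_vector"
  assumes "norm x > 1" and t: "t \<in> closed_segment ((2 / norm x) *\<^sub>R x) x"
  shows "norm t > 1"
proof -
  obtain u where u: "0 \<le> u" "u \<le> 1" "t = (1 - u) *\<^sub>R (2 / norm x) *\<^sub>R x + u *\<^sub>R x"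
    using t by (auto simp: in_segment)
  have "t = ((1 - u) * (2 / norm x) + u) *\<^sub>R x"
    unfolding u(3) by (simp add: scaleR_left_distrib)
  moreover have "(1 - u) * (2 / norm x) + u \<ge> 0" 
    using u assms by simp
  ultimately have "norm t = ((1 - u) * (2 / norm x) + u) * norm x" by simp
  also have "\<dots> = (1 - u) * 2 + u * norm x"
  proof -
    have "(2 / norm x) * norm x = 2" using assms(1) by auto
    then show ?thesis unfolding distrib_right mult.assoc by simp
  qed
  finally have "norm t - 1 = (1 - u) + u * (norm x - 1)" by (simp add: algebra_simps)
  moreover have "(1 - u) + u * (norm x - 1) > 0"
  proof (cases "u = 0")
    case False
    then have "u * (norm x - 1) > 0" using u assms by simp
    then show ?thesis using u by simp
  qed simp
  ultimately show ?thesis by simp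
qed

text \<open>Outside the unit ball the growth bounds follow by integrating along the ray from the sphere of
  radius 2; the exterior itself need not be connected.\<close>
lemma exterior_growth:
  fixes \<phi> :: "'a::euclidean_space \<Rightarrow> real"
  assumes deriv: "\<And>t. norm t > 1 \<Longrightarrow> GDERIV \<phi> t :> \<phi>' t"
    and cont: "continuous_on {t. norm t > 1} \<phi>'"
    and lip: "\<And>x y. closed_segment x y \<subseteq> {t. norm t > 1} \<Longrightarrow> norm (\<phi>' y - \<phi>' x) \<le> D * norm (y - x)"
    and "0 \<le> D"
  obtains C where "0 < C" "\<And>t. norm t > 1 \<Longrightarrow> norm (\<phi>' t) \<le> C * (1 + norm t)"
    "\<And>t. norm t > 1 \<Longrightarrow> \<bar>\<phi> t\<bar> \<le> C * (1 + norm t)\<^sup>2"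
proof -
  have "continuous_on {t. norm t > 1} \<phi>"
    using deriv unfolding gderiv_def
    by (auto intro!: continuous_at_imp_continuous_on has_derivative_continuous)
  \<comment> \<open>The radius 2 keeps the sphere strictly inside the open exterior, where \<phi>
    and its gradient are continuous.\<close>
  then have "compact (\<phi> ` sphere 0 2)" "compact (\<phi>' ` sphere 0 2)"
    using cont by (auto intro!: compact_continuous_image elim!: continuous_on_subset)
  then obtain G0 G1 where G0: "\<And>t. norm t = 2 \<Longrightarrow> \<bar>\<phi> t\<bar> \<le> G0"
    and G1: "\<And>t. norm t = 2 \<Longrightarrow> norm (\<phi>' t) \<le> G1"
    by (force dest!: compact_imp_bounded simp: bounded_iff)
  define C where "C = 1 + \<bar>G0\<bar> + 2 * \<bar>G1\<bar> + 4 * D"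
  have main: "norm (\<phi>' t) \<le> C * (1 + norm t) \<and> \<bar>\<phi> t\<bar> \<le> C * (1 + norm t)\<^sup>2" if t: "norm t > 1" for t
  proof -
    \<comment> \<open>Radial projection onto the sphere of radius 2. The distance \<open>d\<close>
      is the absolute value of \<open>norm t - 2\<close>, so it is at most \<open>1 + norm t\<close>
      even when \<open>t\<close> lies inside that sphere.\<close>
    define s where "s = (2 / norm t) *\<^sub>R t"
    define d where "d = norm (t - s)"
    have ext: "closed_segment s t \<subseteq> {t. norm t > 1}"
      using radial_segment[OF t] by (auto simp: s_def)
    have "norm s = 2" using t by (auto simp: s_def)
    have "t - s = (1 - 2 / norm t) *\<^sub>R t" by (simp add: s_def algebra_simps)
    then have "d = \<bar>1 - 2 / norm t\<bar> * norm t" by (simp add: d_def)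
    also have "\<dots> = \<bar>norm t - 2\<bar>" using t by (auto simp: abs_if field_simps)
    finally have d: "0 \<le> d" "d \<le> 1 + norm t" using t by auto
    have "norm (\<phi>' t) \<le> norm (\<phi>' s) + norm (\<phi>' t - \<phi>' s)" by norm
    also have "\<dots> \<le> \<bar>G1\<bar> + D * d"
      using G1[OF \<open>norm s = 2\<close>] lip[OF ext] by (simp add: d_def)
    also have "\<dots> \<le> \<bar>G1\<bar> * (1 + norm t) + D * (1 + norm t)"
      using d \<open>0 \<le> D\<close> by (intro add_mono mult_left_mono) (auto simp: algebra_simps)
    also have "\<dots> \<le> C * (1 + norm t)"
      unfolding C_def distrib_right[symmetric] using \<open>0 \<le> D\<close> by (intro mult_right_mono) auto
    finally have 1: "norm (\<phi>' t) \<le> C * (1 + norm t)" .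
    have "\<bar>\<phi> t - \<phi> s - \<phi>' s \<bullet> (t - s)\<bar> \<le> D * d\<^sup>2"
      unfolding d_def
    proof (rule gradient_lipschitz_imp_quadratic_remainder)
      fix r assume r: "r \<in> closed_segment s t"
      then show "GDERIV \<phi> r :> \<phi>' r" using deriv ext by auto
      have "closed_segment s r \<subseteq> closed_segment s t"
        using r by (simp add: subset_closed_segment)
      then show "norm (\<phi>' r - \<phi>' s) \<le> D * norm (r - s)"
        using ext lip by (meson order_trans)
    qed fact
    moreover have "\<bar>\<phi>' s \<bullet> (t - s)\<bar> \<le> \<bar>G1\<bar> * d"
      using Cauchy_Schwarz_ineq2[of "\<phi>' s" "t - s"] G1[OF \<open>norm s = 2\<close>] d(1)
      unfolding d_def by (meson abs_ge_self order_trans mult_right_mono norm_ge_zero)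
    ultimately have "\<bar>\<phi> t\<bar> \<le> \<bar>G0\<bar> + \<bar>G1\<bar> * d + D * d\<^sup>2"
      using G0[OF \<open>norm s = 2\<close>] by linarith
    also have "\<dots> \<le> \<bar>G0\<bar> * (1 + norm t)\<^sup>2 + \<bar>G1\<bar> * (1 + norm t)\<^sup>2 + D * (1 + norm t)\<^sup>2"
    proof (intro add_mono mult_left_mono)
      have "1 \<le> (1 + norm t)\<^sup>2" by (simp add: one_le_power)
      then show "\<bar>G0\<bar> \<le> \<bar>G0\<bar> * (1 + norm t)\<^sup>2" by (simp add: mult_le_cancel_left1)
      show "d \<le> (1 + norm t)\<^sup>2" using d
        by (smt (verit) self_le_power norm_ge_zero pos2)
      show "d\<^sup>2 \<le> (1 + norm t)\<^sup>2" using d by (intro power_mono) auto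
    qed (use \<open>0 \<le> D\<close> in auto)
    also have "\<dots> \<le> C * (1 + norm t)\<^sup>2"
      unfolding C_def distrib_right[symmetric] using \<open>0 \<le> D\<close> by (intro mult_right_mono) auto
    finally show ?thesis using 1 by simp
  qed
  moreover have "0 < C" using \<open>0 \<le> D\<close> by (simp add: C_def)
  ultimately show thesis using that by blast
qed

section \<open>The Huber function, a smooth version of the positive part\<close>

text \<open>Projection onto the unit interval. It is the derivative of \<open>huber\<close>, and so
  becomes the weight on the gradient of \<phi>.\<close>

definition clamp01 :: "real \<Rightarrow> real" where
  "clamp01 u = min 1 (max 0 u)"

(* The supremum of s * u - s^2 / 2 over slopes s in [0,1], attained at the projection of u. *)
definition huber :: "real \<Rightarrow> real" where
  "huber u = clamp01 u * u - (clamp01 u)\<^sup>2 / 2"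

lemma clamp01_bounds: "0 \<le> clamp01 u" "clamp01 u \<le> 1"
  by (auto simp: clamp01_def)

lemma huber_eq_0: "u \<le> 0 \<Longrightarrow> huber u = 0"
  by (simp add: huber_def clamp01_def)

lemma huber_eq_linear: "1 \<le> u \<Longrightarrow> huber u = u - 1 / 2"
  by (simp add: huber_def clamp01_def)

text \<open>The projection inequality \<open>(s - ?c) * (u - ?c) \<le> 0\<close> and a square yield
  the supremum property. The slopes 0 and 1 then give the two lower bounds below.\<close>

lemma huber_ge: "0 \<le> s \<Longrightarrow> s \<le> 1 \<Longrightarrow> s * u - s\<^sup>2 / 2 \<le> huber u"
proof -
  assume s: "0 \<le> s" "s \<le> 1"
  let ?c = "clamp01 u"
  have "(s - ?c) * (u - ?c) \<le> 0"
    using s by (auto simp: clamp01_def min_def max_def mult_le_0_iff)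
  moreover have "0 \<le> (s - ?c)\<^sup>2" by simp
  ultimately show ?thesis
    unfolding huber_def by (simp add: power2_eq_square algebra_simps)
qed

lemma huber_nonneg: "0 \<le> huber u"
  using huber_ge[of 0 u] by simp

lemma huber_ge_linear: "u - 1 / 2 \<le> huber u"
  using huber_ge[of 1 u] by simp

lemma huber_le: "huber u \<le> \<bar>u\<bar>"
proof -
  have "clamp01 u * u \<le> clamp01 u * \<bar>u\<bar>"
    using clamp01_bounds(1) by (intro mult_left_mono) auto
  also have "\<dots> \<le> \<bar>u\<bar>"
    using clamp01_bounds by (intro mult_left_le_one_le) auto
  finally have "clamp01 u * u \<le> \<bar>u\<bar>" .
  moreover have "0 \<le> (clamp01 u)\<^sup>2" by simp
  ultimately show ?thesis
    unfolding huber_def by linarith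
qed

text \<open>The derivative of \<open>huber\<close> is 1-Lipschitz, hence the quadratic upper bound.
  Algebraically, the gap is minus the product in the projection inequality for the new slope, plus
  half of the square \<open>(?s' - ?s - h)\<^sup>2\<close>.\<close>

lemma huber_add_le: "huber (u + h) \<le> huber u + clamp01 u * h + h\<^sup>2 / 2"
proof -
  let ?s = "clamp01 u" and ?s' = "clamp01 (u + h)"
  have "(?s' - ?s) * (u - ?s) \<le> 0"
    by (auto simp: clamp01_def min_def max_def mult_le_0_iff)
  moreover have "0 \<le> (?s' - ?s - h)\<^sup>2" by simp
  ultimately show ?thesis
    unfolding huber_def by (simp add: power2_eq_square algebra_simps)
qed

lemma clamp01_borel [measurable]: "clamp01 \<in> borel_measurable borel"
  unfolding clamp01_def by measurable

lemma huber_borel [measurable]: "huber \<in> borel_measurable borel"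
  unfolding huber_def by measurable

section \<open>Asymptotics of the step sizes\<close>

text \<open>Since \<open>p\<close> is positive, \<open>K * a n\<close> is o(1/n), while half an
  increment of the logarithm is of order 1/(2n). Summing the comparison bounds the exponent by half
  of ln n plus a constant.\<close>

lemma exp_sum_steps_bigo:
  fixes a :: "nat \<Rightarrow> real" and p K :: real
  assumes "0 < p" and steps: "\<And>n. n \<ge> 2 \<Longrightarrow> a n = 1 / (real n * ln (real n) powr p)"
  shows "(\<lambda>n. exp (K * (\<Sum>i<n. a i))) \<in> O(\<lambda>n. sqrt (real n))"
proof -
  have "\<forall>\<^sub>F n::nat in sequentially.
      K * (1 / (real n * ln (real n) powr p)) \<le> (ln (real (Suc n)) - ln (real n)) / 2"
    using \<open>0 < p\<close> by real_asymp
  then obtain N where N: "\<And>n. n \<ge> N \<Longrightarrow> 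
      K * (1 / (real n * ln (real n) powr p)) \<le> (ln (real (Suc n)) - ln (real n)) / 2"
    by (auto simp: eventually_sequentially)
  \<comment> \<open>The formula for \<open>a\<close> holds only from index 2 on; \<open>A\<close>
    absorbs the earlier terms.\<close>
  define m where "m = max N 2"
  define A where "A = K * (\<Sum>i<m. a i) - ln (real m) / 2"
  have le: "K * (\<Sum>i<n. a i) \<le> A + ln (real n) / 2" if "n \<ge> m" for n
    using that
  proof (induction n rule: dec_induct)
    case base
    show ?case by (simp add: A_def)
  next
    case (step n)
    then have "K * a n \<le> (ln (real (Suc n)) - ln (real n)) / 2"
      using N[of n] steps[of n] by (simp add: m_def)
    then show ?case
      using step.IH by (simp add: distrib_left diff_divide_distrib del: of_nat_Suc)
  qed
  have "norm (exp (K * (\<Sum>i<n. a i))) \<le> exp A * norm (sqrt (real n))" if "n \<ge> m" for n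
  proof -
    have "n > 0" using that by (simp add: m_def)
    have "exp (K * (\<Sum>i<n. a i)) \<le> exp (A + ln (real n) / 2)"
      using le[OF that] by simp
    also have "\<dots> = exp A * exp (ln (sqrt (real n)))"
      using \<open>n > 0\<close> by (simp add: exp_add ln_sqrt)
    finally show ?thesis using \<open>n > 0\<close> by simp
  qed
  then show ?thesis
    by (intro bigoI[of _ "exp A"]) (auto simp: eventually_sequentially)
qed

text \<open>The squared steps are O(1/n^2) and the exponential costs at most a square root of n,
  which leaves the summable order n^(-3/2).\<close>

lemma summable_sq_steps_exp_sum:
  fixes a :: "nat \<Rightarrow> real" and p K :: real
  assumes "0 < p" and steps: "\<And>n. n \<ge> 2 \<Longrightarrow> a n = 1 / (real n * ln (real n) powr p)"
  shows "summable (\<lambda>n. (a n)\<^sup>2 * exp (K * (\<Sum>i<n. a i)))"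
proof (rule summable_comparison_test_bigo)
  show "summable (\<lambda>n. norm (real n powr (-3/2)))"
    by (simp add: summable_real_powr_iff)
  have "(\<lambda>n. 1 / (real n * ln (real n) powr p)) \<in> O(\<lambda>n. 1 / real n)"
    using \<open>0 < p\<close> by real_asymp
  then have "a \<in> O(\<lambda>n. 1 / real n)"
    by (rule landau_o.big.in_cong[THEN iffD1, rotated])
      (auto simp: eventually_sequentially steps intro!: exI[of _ 2])
  then have "(\<lambda>n. (a n)\<^sup>2 * exp (K * (\<Sum>i<n. a i))) \<in> O(\<lambda>n. (1 / real n)\<^sup>2 * sqrt (real n))"
    by (intro landau_o.big.mult landau_o.big_power exp_sum_steps_bigo[OF assms])
  also have "(\<lambda>n. (1 / real n)\<^sup>2 * sqrt (real n)) \<in> O(\<lambda>n. real n powr (-3/2))"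
    by real_asymp
  finally show "(\<lambda>n. (a n)\<^sup>2 * exp (K * (\<Sum>i<n. a i))) \<in> O(\<lambda>n. real n powr (-3/2))" .
qed

section \<open>The truncated Lyapunov function and its descent inequality\<close>

text \<open>The descent inequality splits into three cases: a small norm, where \<open>\<psi>\<close> vanishes at both ends
  of the step; a large norm, where \<open>\<psi>\<close> is \<open>\<phi>\<close> up to a constant by coercivity; and the bounded
  annulus in between, where the curvature of \<open>huber\<close> costs only a constant times the squared step.\<close>
lemma truncated_lyapunov:
  fixes \<phi> :: "'a::euclidean_space \<Rightarrow> real"
  assumes nonneg: "\<And>t. 0 \<le> \<phi> t"
    and coercive: "filterlim \<phi> at_top at_infinity"
    and borel [measurable]: "\<phi> \<in> borel_measurable borel"
    and ball: "bounded (\<phi> ` cball 0 1)"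
    and deriv: "\<And>t. norm t > 1 \<Longrightarrow> GDERIV \<phi> t :> \<phi>' t"
    and cont: "continuous_on {t. norm t > 1} \<phi>'"
    and lip: "\<And>x y. closed_segment x y \<subseteq> {t. norm t > 1} \<Longrightarrow> norm (\<phi>' y - \<phi>' x) \<le> D * norm (y - x)"
    and "0 \<le> D"
  obtains \<psi> w B C where "0 < C"
    "\<psi> \<in> borel_measurable borel" "w \<in> borel_measurable borel"
    "\<And>t. 0 \<le> \<psi> t" "\<And>t. \<phi> t \<le> \<psi> t + B" "\<And>t. \<psi> t \<le> C * (1 + norm t)\<^sup>2"
    "\<And>t. norm (w t) \<le> C * (1 + norm t)"
    "\<And>t. w t = 0 \<or> norm t > 1 \<and> (\<exists>s\<ge>0. w t = s *\<^sub>R \<phi>' t)"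
    "\<And>t \<delta>. norm \<delta> \<le> (1 + norm t) / 4 \<Longrightarrow> \<psi> (t + \<delta>) \<le> \<psi> t + w t \<bullet> \<delta> + C * (norm \<delta>)\<^sup>2"
proof -
  obtain C0 where C0: "0 < C0" "\<And>t. norm t > 1 \<Longrightarrow> norm (\<phi>' t) \<le> C0 * (1 + norm t)"
    "\<And>t. norm t > 1 \<Longrightarrow> \<bar>\<phi> t\<bar> \<le> C0 * (1 + norm t)\<^sup>2"
    using exterior_growth[OF deriv cont lip \<open>0 \<le> D\<close>] by metis
  obtain B0 where B0: "0 < B0" "\<And>t. norm t \<le> 1 \<Longrightarrow> \<phi> t \<le> B0"
    using ball by (force simp: bounded_pos)
  have growth: "\<phi> t \<le> (B0 + C0) * (1 + norm t)\<^sup>2" for t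
  proof (cases "norm t > 1")
    case True
    have "\<phi> t \<le> C0 * (1 + norm t)\<^sup>2" using C0(3)[OF True] by simp
    also have "\<dots> \<le> (B0 + C0) * (1 + norm t)\<^sup>2"
      using B0(1) by (intro mult_right_mono) auto
    finally show ?thesis .
  next
    case False
    then have "\<phi> t \<le> B0 * 1" using B0(2)[of t] by simp
    also have "\<dots> \<le> (B0 + C0) * (1 + norm t)\<^sup>2"
      using B0(1) C0(1) by (intro mult_mono) (auto intro: one_le_power)
    finally show ?thesis .
  qed
  \<comment> \<open>The factor is (1 + 4)^2, so \<open>B\<close> bounds \<phi> on the ball of radius
    4. A step starting at norm below 3 has length at most (1 + 3)/4 = 1 and stays in that
    ball.\<close>
  define B where "B = (B0 + C0) * 25"
  have "0 < B" using B0(1) C0(1) by (simp add: B_def)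
  have B: "\<phi> t \<le> B" if "norm t \<le> 4" for t
  proof -
    have "(1 + norm t)\<^sup>2 \<le> 5\<^sup>2" using that by (intro power_mono) auto
    then have "(B0 + C0) * (1 + norm t)\<^sup>2 \<le> B"
      unfolding B_def using B0(1) C0(1) by (intro mult_left_mono) auto
    then show ?thesis using growth[of t] by simp
  qed
  obtain R0 where R0: "\<And>t. R0 \<le> norm t \<Longrightarrow> B + 1 \<le> \<phi> t"
    using coercive unfolding filterlim_at_top eventually_at_infinity by meson
  \<comment> \<open>From norm at least \<open>R\<close>, an admissible step loses at most (1 +
    \<open>norm t\<close>)/4, so both of its ends still have norm at least
    \<open>R0\<close>.\<close>
  define R where "R = max 3 (2 * \<bar>R0\<bar> + 1)"
  \<comment> \<open>In the annulus below \<open>R\<close>, \<open>m\<close> bounds the step length,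
    and \<open>G\<close> will bound the increment of \<phi> per unit of step length.\<close>
  define m where "m = (1 + R) / 4"
  define G where "G = C0 * (1 + R) + D * m"
  define C where "C = B0 + C0 + B + D + G\<^sup>2 / 2"
  have "0 < C" using B0(1) C0(1) \<open>0 < B\<close> \<open>0 \<le> D\<close> by (simp add: C_def add_pos_nonneg)
  have C_ge: "B0 + C0 + B \<le> C" "C0 \<le> C" "D + G\<^sup>2 / 2 \<le> C" "D \<le> C"
    using B0(1) C0(1) \<open>0 < B\<close> \<open>0 \<le> D\<close> by (auto simp: C_def intro: add_nonneg_nonneg)
  define s where "s t = clamp01 (\<phi> t - B)" for t
  define \<psi> where "\<psi> t = huber (\<phi> t - B)" for t
  \<comment> \<open>The gradient of \<psi>. Below norm 4 the weight \<open>s\<close> is already 0;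
    the indicator confines \<phi>' to a closed set on which it is continuous, so that
    \<open>w\<close> is Borel whatever \<phi>' is inside the ball.\<close>
  define w where "w t = s t *\<^sub>R (indicator {t. 3 \<le> norm t} t *\<^sub>R \<phi>' t)" for t
  have s: "0 \<le> s t" "s t \<le> 1" for t by (auto simp: s_def clamp01_bounds)
  have w: "w t = s t *\<^sub>R \<phi>' t" if "3 \<le> norm t" for t using that by (simp add: w_def)
  have w0: "w t = 0" if "\<not> 3 \<le> norm t" for t using that by (simp add: w_def)
  show thesis
  proof (rule that[of C \<psi> w "B + 1"])
    show "\<psi> \<in> borel_measurable borel" unfolding \<psi>_def by measurable
    have "(\<lambda>t. indicator {t. 3 \<le> norm t} t *\<^sub>R \<phi>' t) \<in> borel_measurable borel"
      by (intro borel_measurable_continuous_on_indicator continuous_on_subset[OF cont]) auto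
    moreover have "s \<in> borel_measurable borel" unfolding s_def by measurable
    ultimately show "w \<in> borel_measurable borel" unfolding w_def by measurable
    show "0 \<le> \<psi> t" for t by (simp add: \<psi>_def huber_nonneg)
    show "\<phi> t \<le> \<psi> t + (B + 1)" for t using huber_ge_linear[of "\<phi> t - B"] by (simp add: \<psi>_def)
    show "\<psi> t \<le> C * (1 + norm t)\<^sup>2" for t
    proof -
      have "\<psi> t \<le> \<bar>\<phi> t - B\<bar>" by (simp add: \<psi>_def huber_le)
      also have "\<dots> \<le> (B0 + C0) * (1 + norm t)\<^sup>2 + B * 1"
        using growth[of t] nonneg[of t] \<open>0 < B\<close> by linarith
      also have "\<dots> \<le> (B0 + C0) * (1 + norm t)\<^sup>2 + B * (1 + norm t)\<^sup>2"
        using \<open>0 < B\<close> B0(1) C0(1)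
        by (intro add_mono mult_left_mono) (auto intro: one_le_power)
      also have "\<dots> \<le> C * (1 + norm t)\<^sup>2"
        unfolding distrib_right[symmetric] by (intro mult_right_mono C_ge) auto
      finally show ?thesis .
    qed
    show "norm (w t) \<le> C * (1 + norm t)" for t
    proof (cases "3 \<le> norm t")
      case True
      have "norm (w t) \<le> norm (\<phi>' t)"
        using s[of t] by (simp add: w[OF True] mult_left_le_one_le)
      also have "\<dots> \<le> C0 * (1 + norm t)" using C0(2)[of t] True by simp
      also have "\<dots> \<le> C * (1 + norm t)" by (intro mult_right_mono C_ge) auto
      finally show ?thesis .
    qed (use \<open>0 < C\<close> in \<open>simp add: w0\<close>)
    show "w t = 0 \<or> norm t > 1 \<and> (\<exists>s\<ge>0. w t = s *\<^sub>R \<phi>' t)" for t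
      using w[of t] w0[of t] s(1)[of t] by force
  next
    fix t \<delta> :: 'a
    assume \<delta>: "norm \<delta> \<le> (1 + norm t) / 4"
    show "\<psi> (t + \<delta>) \<le> \<psi> t + w t \<bullet> \<delta> + C * (norm \<delta>)\<^sup>2"
    proof (cases "3 \<le> norm t")
      case False
      moreover have "norm (t + \<delta>) \<le> 4"
        using False \<delta> norm_triangle_ineq[of t \<delta>] by simp
      ultimately show ?thesis
        using B[of t] B[of "t + \<delta>"] \<open>0 < C\<close> by (simp add: \<psi>_def huber_eq_0 w0)
    next
      case True
      define h where "h = \<phi> (t + \<delta>) - \<phi> t"
      \<comment> \<open>From norm at least 3, the norm along the segment stays at least (3
        \<open>norm t\<close> - 1)/4, hence at least 2.\<close>
      have ext: "closed_segment t (t + \<delta>) \<subseteq> {t. norm t > 1}"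
        using norm_ge_on_closed_segment[of _ t "t + \<delta>"] True \<delta> by fastforce
      have "\<bar>\<phi> (t + \<delta>) - \<phi> t - \<phi>' t \<bullet> ((t + \<delta>) - t)\<bar> \<le> D * (norm ((t + \<delta>) - t))\<^sup>2"
      proof (rule gradient_lipschitz_imp_quadratic_remainder)
        fix r assume r: "r \<in> closed_segment t (t + \<delta>)"
        then show "GDERIV \<phi> r :> \<phi>' r" using deriv ext by auto
        have "closed_segment t r \<subseteq> closed_segment t (t + \<delta>)"
          using r by (simp add: subset_closed_segment)
        then show "norm (\<phi>' r - \<phi>' t) \<le> D * norm (r - t)"
          using ext lip by (meson order_trans)
      qed fact
      then have taylor: "\<bar>h - \<phi>' t \<bullet> \<delta>\<bar> \<le> D * (norm \<delta>)\<^sup>2" by (simp add: h_def)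
      show ?thesis
      proof (cases "R \<le> norm t")
        case large: True
        have "norm t - norm \<delta> \<le> norm (t + \<delta>)" by norm
        then have "R0 \<le> norm (t + \<delta>)" "R0 \<le> norm t"
          using large \<delta> by (auto simp: R_def)
        \<comment> \<open>Both ends lie where \<open>huber\<close> is affine with slope one, so the
          Taylor bound for \<phi> carries over unchanged.\<close>
        then have "1 \<le> \<phi> (t + \<delta>) - B" "1 \<le> \<phi> t - B"
          using R0[of t] R0[of "t + \<delta>"] by auto
        then have "\<psi> (t + \<delta>) = \<psi> t + h" "s t = 1"
          by (simp_all add: \<psi>_def huber_eq_linear h_def s_def clamp01_def)
        moreover have "D * (norm \<delta>)\<^sup>2 \<le> C * (norm \<delta>)\<^sup>2"
          by (intro mult_right_mono C_ge) auto
        ultimately show ?thesis using taylor w[OF True] by simp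
      next
        case False
        then have "norm \<delta> \<le> m" using \<delta> by (simp add: m_def)
        have "\<bar>\<phi>' t \<bullet> \<delta>\<bar> \<le> norm (\<phi>' t) * norm \<delta>" by (rule Cauchy_Schwarz_ineq2)
        also have "\<dots> \<le> (C0 * (1 + norm t)) * norm \<delta>"
          using C0(2)[of t] True by (intro mult_right_mono) auto
        also have "\<dots> \<le> (C0 * (1 + R)) * norm \<delta>"
          using False C0(1) by (intro mult_right_mono mult_left_mono) auto
        finally have "\<bar>\<phi>' t \<bullet> \<delta>\<bar> \<le> (C0 * (1 + R)) * norm \<delta>" .
        moreover have "D * (norm \<delta>)\<^sup>2 \<le> (D * m) * norm \<delta>"
          using \<open>norm \<delta> \<le> m\<close> \<open>0 \<le> D\<close>
          by (simp add: power2_eq_square mult.assoc mult_left_mono mult_right_mono)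
        \<comment> \<open>A linear bound on the increment turns the term
          \<open>h\<^sup>2 / 2\<close> from \<open>huber_add_le\<close> into a multiple of the
          squared step.\<close>
        ultimately have "\<bar>h\<bar> \<le> G * norm \<delta>"
          using taylor unfolding G_def distrib_right by linarith
        then have "\<bar>h\<bar>\<^sup>2 \<le> (G * norm \<delta>)\<^sup>2" by (intro power_mono) auto
        then have h2: "h\<^sup>2 / 2 \<le> G\<^sup>2 / 2 * (norm \<delta>)\<^sup>2" by (simp add: power_mult_distrib)
        have "s t * h \<le> s t * (\<phi>' t \<bullet> \<delta> + D * (norm \<delta>)\<^sup>2)"
          using taylor s by (intro mult_left_mono) auto
        also have "\<dots> \<le> w t \<bullet> \<delta> + D * (norm \<delta>)\<^sup>2"
          using s[of t] \<open>0 \<le> D\<close> by (simp add: w[OF True] distrib_left mult_left_le_one_le)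
        finally have "s t * h + h\<^sup>2 / 2 \<le> w t \<bullet> \<delta> + (D + G\<^sup>2 / 2) * (norm \<delta>)\<^sup>2"
          using h2 by (simp add: distrib_right)
        also have "\<dots> \<le> w t \<bullet> \<delta> + C * (norm \<delta>)\<^sup>2"
          by (intro add_left_mono mult_right_mono C_ge) auto
        finally show ?thesis
          using huber_add_le[of "\<phi> t - B" h] by (simp add: \<psi>_def h_def s_def)
      qed
    qed
  qed fact
qed

section \<open>The history and orthogonality of the martingale noise\<close>

lemma subalgebra_sigma:
  assumes "G \<subseteq> sets P" shows "subalgebra P (sigma (space P) G)"
proof -
  have "G \<subseteq> Pow (space P)" using assms sets.space_closed by (rule order_trans)
  then show ?thesis
    unfolding subalgebra_def using sets.sigma_sets_subset[OF assms]
    by (simp add: space_measure_of_conv sets_measure_of)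
qed

lemma subalgebra_history:
  assumes "\<And>n. \<theta> n \<in> borel_measurable P" "\<And>n. Y n \<in> borel_measurable P"
    and "\<And>n. M (Suc n) \<in> borel_measurable P"
  shows "subalgebra P (history P \<theta> Y M n)"
proof -
  \<comment> \<open>The measurability hypothesis is stated at successor indices, so \<open>m\<close>
    is read as \<open>Suc (m - 1)\<close>.\<close>
  have "M m -` A \<inter> space P \<in> sets P" if "1 \<le> m" "A \<in> sets borel" for m A
    using measurable_sets[OF assms(3)[of "m - 1"] that(2)] that(1) by simp
  then have "{\<theta> m -` A \<inter> space P | m A. m \<le> n \<and> A \<in> sets borel} \<union>
      {Y m -` B \<inter> space P | m B. m \<le> n \<and> B \<in> sets borel} \<union>
      {M m -` A \<inter> space P | m A. 1 \<le> m \<and> m \<le> n \<and> A \<in> sets borel} \<subseteq> sets P"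
    using measurable_sets[OF assms(1)] measurable_sets[OF assms(2)] by blast
  then show ?thesis
    unfolding subalgebra_def history_def
    by (rule subalgebra_sigma[unfolded subalgebra_def])
qed

lemma iterate_measurable_history:
  fixes \<theta> M :: "nat \<Rightarrow> 'w \<Rightarrow> real ^ 'd" and Y :: "nat \<Rightarrow> 'w \<Rightarrow> real ^ 'k"
  shows
  "\<theta> n \<in> borel_measurable (history P \<theta> Y M n)"
proof (rule measurableI)
  fix A :: "(real ^ 'd) set" assume A: "A \<in> sets borel"
  let ?G = "{\<theta> m -` A \<inter> space P | m A. m \<le> n \<and> A \<in> sets borel} \<union>
      {Y m -` B \<inter> space P | m B. m \<le> n \<and> B \<in> sets borel} \<union>
      {M m -` A \<inter> space P | m A. 1 \<le> m \<and> m \<le> n \<and> A \<in> sets borel}"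
  have "?G \<subseteq> Pow (space P)" by auto
  moreover have "\<theta> n -` A \<inter> space P \<in> ?G"
    using A by (intro UnI1 CollectI exI[of _ n] exI[of _ A]) simp
  ultimately show "\<theta> n -` A \<inter> space (history P \<theta> Y M n) \<in> sets (history P \<theta> Y M n)"
    unfolding history_def space_measure_of_conv by (rule in_measure_of)
qed simp

text \<open>In each coordinate the factor known at time \<open>n\<close> is pulled out of the
  conditional expectation, which vanishes. The integrable product of norms dominates every
  coordinate product.\<close>

lemma martingale_difference_orthogonal:
  fixes M :: "nat \<Rightarrow> 'w \<Rightarrow> real ^ 'd"
  assumes "prob_space P" and sub: "subalgebra P (F n)"
    and mds: "martingale_difference P F M"
    and W: "W \<in> borel_measurable (F n)"
    and int: "integrable P (\<lambda>\<omega>. norm (W \<omega>) * norm (M (Suc n) \<omega>))"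
  shows "integrable P (\<lambda>\<omega>. W \<omega> \<bullet> M (Suc n) \<omega>)" "(\<integral>\<omega>. W \<omega> \<bullet> M (Suc n) \<omega> \<partial>P) = 0"
proof -
  interpret prob_space P by fact
  interpret finite_measure_subalgebra P "F n"
    by unfold_locales (rule sub)
  have "integrable P (M (Suc n))"
    and M0: "\<And>i. AE \<omega> in P. real_cond_exp P (F n) (\<lambda>\<omega>. M (Suc n) \<omega> $ i) \<omega> = 0"
    using mds unfolding martingale_difference_def by auto
  then have M [measurable]: "M (Suc n) \<in> borel_measurable P" by simp
  have WP [measurable]: "W \<in> borel_measurable P"
    by (rule measurable_from_subalg[OF sub W])
  have nth: "(\<lambda>x. x $ i) \<in> borel_measurable borel" for i :: 'd
    by (intro borel_measurable_continuous_onI continuous_intros)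
  have int_i: "integrable P (\<lambda>\<omega>. W \<omega> $ i * M (Suc n) \<omega> $ i)" for i
  proof (rule Bochner_Integration.integrable_bound[OF int])
    show "(\<lambda>\<omega>. W \<omega> $ i * M (Suc n) \<omega> $ i) \<in> borel_measurable P"
      by (intro borel_measurable_times measurable_compose[OF WP] measurable_compose[OF M] nth)
    show "AE \<omega> in P. norm (W \<omega> $ i * M (Suc n) \<omega> $ i) \<le> norm (norm (W \<omega>) * norm (M (Suc n) \<omega>))"
      by (auto simp: abs_mult intro!: mult_mono component_le_norm_cart)
  qed
  have zero_i: "(\<integral>\<omega>. W \<omega> $ i * M (Suc n) \<omega> $ i \<partial>P) = 0" for i
  proof -
    have "(\<lambda>\<omega>. W \<omega> $ i) \<in> borel_measurable (F n)"
      by (rule measurable_compose[OF W nth])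
    then have "(\<integral>\<omega>. W \<omega> $ i * M (Suc n) \<omega> $ i \<partial>P)
        = (\<integral>\<omega>. W \<omega> $ i * real_cond_exp P (F n) (\<lambda>\<omega>. M (Suc n) \<omega> $ i) \<omega> \<partial>P)"
      using int_i[of i] measurable_compose[OF M nth] by (intro real_cond_exp_intg(2)[symmetric])
    also have "\<dots> = 0"
      using M0[of i] by (intro integral_eq_zero_AE) auto
    finally show ?thesis .
  qed
  show "integrable P (\<lambda>\<omega>. W \<omega> \<bullet> M (Suc n) \<omega>)"
    using int_i by (simp add: inner_vec_def)
  show "(\<integral>\<omega>. W \<omega> \<bullet> M (Suc n) \<omega> \<partial>P) = 0"
    using int_i zero_i by (simp add: inner_vec_def)
qed

section \<open>Discrete Gronwall inequality\<close>

lemma discrete_gronwall_exp: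
  fixes r a :: "nat \<Rightarrow> real"
  assumes "\<And>n. r (Suc n) \<le> (1 + b n) * r n" "\<And>n. 0 \<le> r n"
  shows "r n \<le> exp (\<Sum>i<n. b i) * r 0"
proof (induction n)
  case (Suc n)
  have "r (Suc n) \<le> exp (b n) * r n"
    using assms(1)[of n] mult_right_mono[OF exp_ge_add_one_self assms(2)[of n]] by (meson order_trans)
  also have "\<dots> \<le> exp (b n) * (exp (\<Sum>i<n. b i) * r 0)"
    using Suc by simp
  finally show ?case by (simp add: exp_add mult_ac)
qed simp

section \<open>Boundedness of the expected Lyapunov function\<close>

text \<open>The expectation is an integral with values in [0, \<infinity>], so no integrability is
  presupposed. The second moment in \<open>init\<close> starts the moment bound, and
  \<open>\<phi>_ball\<close> controls \<phi> where (S1) says nothing.\<close>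

theorem mainTheorem8:
  fixes P :: "'w measure"
    and \<theta> M :: "nat \<Rightarrow> 'w \<Rightarrow> real ^ 'd"
    and Y :: "nat \<Rightarrow> 'w \<Rightarrow> real ^ 'k"
    and a :: "nat \<Rightarrow> real"
    and f :: "real ^ 'd \<Rightarrow> real ^ 'k \<Rightarrow> real ^ 'd"
    and \<kappa> :: "real ^ 'd \<Rightarrow> real ^ 'k \<Rightarrow> (real ^ 'k) measure"
    and \<Gamma> :: "real ^ 'd \<Rightarrow> (real ^ 'k) measure"
    and v :: "real ^ 'd \<Rightarrow> real ^ 'k \<Rightarrow> real ^ 'd"
    and \<phi> :: "real ^ 'd \<Rightarrow> real"
    and \<phi>' :: "real ^ 'd \<Rightarrow> real ^ 'd"
    and \<phi>'' :: "real ^ 'd \<Rightarrow> real ^ 'd ^ 'd"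
    and Cbar K0 K' L c p :: real
  assumes prob: "prob_space P"
    and rv_\<theta>: "\<And>n. \<theta> n \<in> borel_measurable P"
    and rv_Y: "\<And>n. Y n \<in> borel_measurable P"
    and rv_M: "\<And>n. M (Suc n) \<in> borel_measurable P"
    and f_borel: "(\<lambda>(t, y). f t y) \<in> borel_measurable (borel \<Otimes>\<^sub>M borel)"
    and recursion: "\<And>n \<omega>. \<omega> \<in> space P \<Longrightarrow>
          \<theta> (Suc n) \<omega> = \<theta> n \<omega> + a n *\<^sub>R (f (\<theta> n \<omega>) (Y n \<omega>) + M (Suc n) \<omega>)"
    and kernel: "\<And>t. transition_kernel (\<kappa> t)"
    and markov: "iterate_dependent_markov P (history P \<theta> Y M) \<kappa> \<theta> Y"
    and mds: "martingale_difference P (history P \<theta> Y M) M"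
    and init: "integrable P (\<lambda>\<omega>. (norm (\<theta> 0 \<omega>))\<^sup>2)"
    and A1: "Cbar > 0" "AE \<omega> in P. limsup (\<lambda>n. ereal (norm (Y n \<omega>))) < ereal Cbar"
    and A2: "K0 > 0" "\<And>t y. norm (f t y) \<le> K0 * (1 + norm t)"
    and A3: "decseq a" "\<And>n. a n > 0"
          "filterlim (\<lambda>n. \<Sum>i<n. a i) at_top sequentially" "summable (\<lambda>n. (a n)\<^sup>2)"
    and A4: "\<And>t. invariant_prob (\<kappa> t) (\<Gamma> t)"
          "\<And>t \<mu>. invariant_prob (\<kappa> t) \<mu> \<Longrightarrow> \<mu> = \<Gamma> t"
          "L > 0" "L-lipschitz_on UNIV (\<lambda>t. \<integral>y. f t y \<partial>\<Gamma> t)"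
    and A5: "\<And>n. AE \<omega> in P. norm (M (Suc n) \<omega>) \<le> K' * (1 + norm (\<theta> n \<omega>))"
    and A6: "\<And>t x. integrable (\<kappa> t x) (v t)"
          "\<And>t x. v t x - (\<integral>y. v t y \<partial>\<kappa> t x) = f t x - (\<integral>y. f t y \<partial>\<Gamma> t)"
    and A7: "\<And>R. R > 0 \<Longrightarrow> \<exists>C>0.
          (\<forall>t x. norm t \<le> R \<longrightarrow> norm (v t x) \<le> C * (1 + norm x)) \<and>
          (\<forall>t t' x. norm t \<le> R \<longrightarrow> norm t' \<le> R \<longrightarrow>
             norm (v t x - v t' x) \<le> C * norm (t - t') * (1 + norm x))"
    and \<phi>_nonneg: "\<And>t. \<phi> t \<ge> 0"
    and \<phi>_coercive: "filterlim \<phi> at_top at_infinity"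
    and \<phi>_borel: "\<phi> \<in> borel_measurable borel"
    and \<phi>_ball: "bounded (\<phi> ` cball 0 1)"
    and S1: "\<And>t. norm t > 1 \<Longrightarrow> GDERIV \<phi> t :> \<phi>' t"
          "\<And>t. norm t > 1 \<Longrightarrow> (\<phi>' has_derivative (\<lambda>x. \<phi>'' t *v x)) (at t)"
          "\<And>t i j. norm t > 1 \<Longrightarrow> \<bar>\<phi>'' t $ i $ j\<bar> \<le> c"
    and S2: "\<And>t K y. norm t > 1 \<Longrightarrow> compact K \<Longrightarrow> y \<in> K \<Longrightarrow> \<phi>' t \<bullet> f t y \<le> 0"
    and p: "0 < p" "p \<le> 1"
    and steps: "\<And>n. n \<ge> 2 \<Longrightarrow> a n = 1 / (real n * ln (real n) powr p)"
  shows "liminf (\<lambda>n. \<integral>\<^sup>+ \<omega>. ennreal (\<phi> (\<theta> n \<omega>)) \<partial>P) < \<infinity>"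
proof -
  interpret prob_space P by (rule prob)
  note [measurable] = rv_\<theta> rv_Y rv_M
  define D where "D = (real CARD('d))\<^sup>2 * c"
  \<comment> \<open>A point of norm 2 exists, and the entry bound there forces \<open>c\<close> to
    be nonnegative.\<close>
  have "\<bar>\<phi>'' (2 *\<^sub>R axis i 1) $ i $ i\<bar> \<le> c" for i
    by (rule S1(3)) simp
  then have "0 \<le> c" by (meson abs_ge_zero order_trans)
  then have "0 \<le> D" by (simp add: D_def)
  have cont: "continuous_on {t. norm t > 1} \<phi>'"
    using S1(2) by (auto intro!: continuous_at_imp_continuous_on has_derivative_continuous)
  have lip: "norm (\<phi>' y - \<phi>' x) \<le> D * norm (y - x)"
    if "closed_segment x y \<subseteq> {t. norm t > 1}" for x y
    unfolding D_def using that S1(2,3)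
    by (intro bounded_hessian_imp_gradient_lipschitz[where \<phi>'' = \<phi>'']) auto
  obtain \<psi> w B C where "0 < C"
    and \<psi>_borel [measurable]: "\<psi> \<in> borel_measurable borel"
    and w_borel [measurable]: "w \<in> borel_measurable borel"
    and \<psi>: "\<And>t. 0 \<le> \<psi> t" "\<And>t. \<phi> t \<le> \<psi> t + B" "\<And>t. \<psi> t \<le> C * (1 + norm t)\<^sup>2"
    and w: "\<And>t. norm (w t) \<le> C * (1 + norm t)"
    and w_dir: "\<And>t. w t = 0 \<or> norm t > 1 \<and> (\<exists>s\<ge>0. w t = s *\<^sub>R \<phi>' t)"
    and descent: "\<And>t \<delta>. norm \<delta> \<le> (1 + norm t) / 4 \<Longrightarrow>
      \<psi> (t + \<delta>) \<le> \<psi> t + w t \<bullet> \<delta> + C * (norm \<delta>)\<^sup>2"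
    using truncated_lyapunov[OF \<phi>_nonneg \<phi>_coercive \<phi>_borel \<phi>_ball S1(1) cont lip \<open>0 \<le> D\<close>] by metis
  have wf: "w t \<bullet> f t y \<le> 0" for t y
    using w_dir[of t] S2[of t "{y}" y] by (auto simp: mult_nonneg_nonpos)

  \<comment> \<open>Step lengths and second moments of the iterates\<close>
  define K where "K = K0 + \<bar>K'\<bar>"
  have "0 < K" using A2(1) by (simp add: K_def)
  define X where "X n \<omega> = 1 + norm (\<theta> n \<omega>)" for n \<omega>
  have X_ge: "1 \<le> X n \<omega>" for n \<omega> by (simp add: X_def)
  have X_nonneg: "0 \<le> X n \<omega>" for n \<omega> by (simp add: X_def)
  have X_meas [measurable]: "X n \<in> borel_measurable P" for n unfolding X_def by measurable
  \<comment> \<open>Countably many null sets are merged, so that Gronwall can be run along a single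
    path.\<close>
  have "AE \<omega> in P. \<forall>n. norm (M (Suc n) \<omega>) \<le> K' * X n \<omega>"
    using A5 by (simp add: X_def AE_all_countable)
  then have M_bound: "AE \<omega> in P. \<forall>n. norm (M (Suc n) \<omega>) \<le> \<bar>K'\<bar> * X n \<omega>"
  proof (rule AE_mp, intro AE_I2 impI allI)
    fix \<omega> n assume "\<forall>n. norm (M (Suc n) \<omega>) \<le> K' * X n \<omega>"
    then have "norm (M (Suc n) \<omega>) \<le> K' * X n \<omega>" by simp
    also have "\<dots> \<le> \<bar>K'\<bar> * X n \<omega>" using X_ge[of n \<omega>] by (intro mult_right_mono) auto
    finally show "norm (M (Suc n) \<omega>) \<le> \<bar>K'\<bar> * X n \<omega>" .
  qed
  define \<delta> where "\<delta> n \<omega> = a n *\<^sub>R (f (\<theta> n \<omega>) (Y n \<omega>) + M (Suc n) \<omega>)" for n \<omega>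
  have \<delta>_bound: "AE \<omega> in P. \<forall>n. norm (\<delta> n \<omega>) \<le> a n * K * X n \<omega>"
    using M_bound
  proof (rule AE_mp, intro AE_I2 impI allI)
    fix \<omega> n assume "\<forall>n. norm (M (Suc n) \<omega>) \<le> \<bar>K'\<bar> * X n \<omega>"
    then have "norm (f (\<theta> n \<omega>) (Y n \<omega>) + M (Suc n) \<omega>) \<le> K * X n \<omega>"
      using A2(2)[of "\<theta> n \<omega>" "Y n \<omega>"] norm_triangle_ineq[of "f (\<theta> n \<omega>) (Y n \<omega>)" "M (Suc n) \<omega>"]
      unfolding K_def X_def distrib_right by (smt (verit))
    then show "norm (\<delta> n \<omega>) \<le> a n * K * X n \<omega>"
      using A3(2)[of n] by (simp add: \<delta>_def)
  qed

  define E where "E n = exp (2 * K * (\<Sum>i<n. a i))" for n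
  define q where "q = (\<integral>\<omega>. (X 0 \<omega>)\<^sup>2 \<partial>P)"
  have X0_int: "integrable P (\<lambda>\<omega>. (X 0 \<omega>)\<^sup>2)"
  proof (rule Bochner_Integration.integrable_bound)
    show "integrable P (\<lambda>\<omega>. 2 + 2 * (norm (\<theta> 0 \<omega>))\<^sup>2)" using init by simp
    have "(X 0 \<omega>)\<^sup>2 \<le> 2 + 2 * (norm (\<theta> 0 \<omega>))\<^sup>2" for \<omega>
      using zero_le_power2[of "1 - norm (\<theta> 0 \<omega>)"] by (simp add: X_def power2_eq_square algebra_simps)
    then show "AE \<omega> in P. norm ((X 0 \<omega>)\<^sup>2) \<le> norm (2 + 2 * (norm (\<theta> 0 \<omega>))\<^sup>2)" by simp
  qed measurable
  \<comment> \<open>The bound is pathwise, so it gives integrability as well as the moment estimate.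
    Squaring the Gronwall factor produces the 2 in \<open>E\<close>.\<close>
  have X_growth: "AE \<omega> in P. \<forall>n. (X n \<omega>)\<^sup>2 \<le> E n * (X 0 \<omega>)\<^sup>2"
    using \<delta>_bound
  proof (rule AE_mp, intro AE_I2 impI allI)
    fix \<omega> n assume \<omega>: "\<omega> \<in> space P" and b: "\<forall>n. norm (\<delta> n \<omega>) \<le> a n * K * X n \<omega>"
    have "X (Suc n) \<omega> \<le> (1 + K * a n) * X n \<omega>" for n
    proof -
      have "\<theta> (Suc n) \<omega> = \<theta> n \<omega> + \<delta> n \<omega>"
        using recursion[OF \<omega>, of n] by (simp add: \<delta>_def)
      then show ?thesis
        using b[rule_format, of n] norm_triangle_ineq[of "\<theta> n \<omega>" "\<delta> n \<omega>"]
        by (simp add: X_def algebra_simps)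
    qed
    then have "X n \<omega> \<le> exp (\<Sum>i<n. K * a i) * X 0 \<omega>"
      using X_nonneg by (rule discrete_gronwall_exp[where r = "\<lambda>n. X n \<omega>" and b = "\<lambda>n. K * a n"])
    then have "(X n \<omega>)\<^sup>2 \<le> (exp (\<Sum>i<n. K * a i) * X 0 \<omega>)\<^sup>2"
      using X_ge[of n \<omega>] by (intro power_mono) auto
    then show "(X n \<omega>)\<^sup>2 \<le> E n * (X 0 \<omega>)\<^sup>2"
      by (simp add: E_def power_mult_distrib exp_double[symmetric] sum_distrib_left mult_ac)
  qed
  have X_int: "integrable P (\<lambda>\<omega>. (X n \<omega>)\<^sup>2)" for n
  proof (rule Bochner_Integration.integrable_bound)
    show "integrable P (\<lambda>\<omega>. E n * (X 0 \<omega>)\<^sup>2)" using X0_int by simp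
    show "AE \<omega> in P. norm ((X n \<omega>)\<^sup>2) \<le> norm (E n * (X 0 \<omega>)\<^sup>2)"
      using X_growth by eventually_elim (simp add: E_def)
  qed measurable
  have EX: "(\<integral>\<omega>. (X n \<omega>)\<^sup>2 \<partial>P) \<le> E n * q" for n
  proof -
    have "(\<integral>\<omega>. (X n \<omega>)\<^sup>2 \<partial>P) \<le> (\<integral>\<omega>. E n * (X 0 \<omega>)\<^sup>2 \<partial>P)"
      using X_int X0_int X_growth by (intro integral_mono_AE) auto
    then show ?thesis by (simp add: q_def)
  qed

  \<comment> \<open>Integrability, and vanishing mean of the noise term\<close>
  have \<psi>_int: "integrable P (\<lambda>\<omega>. \<psi> (\<theta> n \<omega>))" for n
  proof (rule Bochner_Integration.integrable_bound)
    show "integrable P (\<lambda>\<omega>. C * (X n \<omega>)\<^sup>2)" using X_int by simp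
    show "AE \<omega> in P. norm (\<psi> (\<theta> n \<omega>)) \<le> norm (C * (X n \<omega>)\<^sup>2)"
      using \<psi>(1,3) \<open>0 < C\<close> by (simp add: X_def)
  qed measurable
  have wM: "integrable P (\<lambda>\<omega>. w (\<theta> n \<omega>) \<bullet> M (Suc n) \<omega>)" "(\<integral>\<omega>. w (\<theta> n \<omega>) \<bullet> M (Suc n) \<omega> \<partial>P) = 0" for n
  proof -
    have "integrable P (\<lambda>\<omega>. norm (w (\<theta> n \<omega>)) * norm (M (Suc n) \<omega>))"
    proof (rule Bochner_Integration.integrable_bound)
      show "integrable P (\<lambda>\<omega>. C * \<bar>K'\<bar> * (X n \<omega>)\<^sup>2)" using X_int by simp
      show "AE \<omega> in P. norm (norm (w (\<theta> n \<omega>)) * norm (M (Suc n) \<omega>)) \<le> norm (C * \<bar>K'\<bar> * (X n \<omega>)\<^sup>2)"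
        using M_bound
      proof eventually_elim
        case (elim \<omega>)
        have "norm (w (\<theta> n \<omega>)) * norm (M (Suc n) \<omega>) \<le> (C * X n \<omega>) * (\<bar>K'\<bar> * X n \<omega>)"
          using elim w[of "\<theta> n \<omega>"] \<open>0 < C\<close> X_ge[of n \<omega>] by (intro mult_mono) (auto simp: X_def)
        then show ?case using \<open>0 < C\<close> by (simp add: power2_eq_square mult_ac abs_mult)
      qed
    qed measurable
    moreover have "(\<lambda>\<omega>. w (\<theta> n \<omega>)) \<in> borel_measurable (history P \<theta> Y M n)"
      using iterate_measurable_history w_borel by (rule measurable_compose)
    moreover have "subalgebra P (history P \<theta> Y M n)"
      by (intro subalgebra_history rv_\<theta> rv_Y rv_M)
    ultimately show "integrable P (\<lambda>\<omega>. w (\<theta> n \<omega>) \<bullet> M (Suc n) \<omega>)"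
      "(\<integral>\<omega>. w (\<theta> n \<omega>) \<bullet> M (Suc n) \<omega> \<partial>P) = 0"
      using martingale_difference_orthogonal[where F = "history P \<theta> Y M", OF prob _ mds] by auto
  qed

  \<comment> \<open>Summable increments of the expectation of \<psi>\<close>
  have "(\<lambda>n. \<bar>a n\<bar>) \<longlonglongrightarrow> 0"
    using tendsto_real_sqrt[OF summable_LIMSEQ_zero[OF A3(4)]] by simp
  then have "\<forall>\<^sub>F n in sequentially. \<bar>a n\<bar> < 1 / (4 * K)"
    by (rule order_tendstoD) (use \<open>0 < K\<close> in simp)
  then have "\<forall>\<^sub>F n in sequentially. a n * K \<le> 1 / 4"
    by eventually_elim (use \<open>0 < K\<close> A3(2) in \<open>simp add: field_simps abs_of_pos\<close>)
  \<comment> \<open>The threshold 1/4 makes the increment admissible for \<open>descent\<close>,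
    since its norm is at most \<open>a n * K * X n \<omega>\<close>.\<close>
  then obtain N where N: "\<And>n. n \<ge> N \<Longrightarrow> a n * K \<le> 1 / 4"
    unfolding eventually_sequentially by metis
  define b where "b n = C * K\<^sup>2 * q * ((a n)\<^sup>2 * E n)" for n
  define e where "e n = (\<integral>\<omega>. \<psi> (\<theta> n \<omega>) \<partial>P)" for n
  have step: "e (Suc n) \<le> e n + b n" if "n \<ge> N" for n
  proof -
    have "AE \<omega> in P. \<psi> (\<theta> (Suc n) \<omega>) \<le>
        \<psi> (\<theta> n \<omega>) + a n * (w (\<theta> n \<omega>) \<bullet> M (Suc n) \<omega>) + C * (a n * K)\<^sup>2 * (X n \<omega>)\<^sup>2"
      using \<delta>_bound
    proof (rule AE_mp, intro AE_I2 impI)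
      fix \<omega> assume \<omega>: "\<omega> \<in> space P" and "\<forall>n. norm (\<delta> n \<omega>) \<le> a n * K * X n \<omega>"
      then have d: "norm (\<delta> n \<omega>) \<le> a n * K * X n \<omega>" by simp
      also have "\<dots> \<le> 1 / 4 * X n \<omega>"
        using N[OF that] X_ge[of n \<omega>] by (intro mult_right_mono) auto
      finally have "\<psi> (\<theta> n \<omega> + \<delta> n \<omega>) \<le>
          \<psi> (\<theta> n \<omega>) + w (\<theta> n \<omega>) \<bullet> \<delta> n \<omega> + C * (norm (\<delta> n \<omega>))\<^sup>2"
        by (intro descent) (simp add: X_def)
      \<comment> \<open>The drift part is nonpositive by \<open>wf\<close> and is dropped; only the
        noise part remains, and it integrates to zero.\<close>
      moreover have "w (\<theta> n \<omega>) \<bullet> \<delta> n \<omega> \<le> a n * (w (\<theta> n \<omega>) \<bullet> M (Suc n) \<omega>)"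
        using wf[of "\<theta> n \<omega>" "Y n \<omega>"] A3(2)[of n]
        by (simp add: \<delta>_def inner_add_right distrib_left mult_nonneg_nonpos)
      moreover have "C * (norm (\<delta> n \<omega>))\<^sup>2 \<le> C * (a n * K)\<^sup>2 * (X n \<omega>)\<^sup>2"
        using mult_left_mono[OF power_mono[OF d norm_ge_zero, of 2], of C] \<open>0 < C\<close>
        by (simp add: power_mult_distrib mult.assoc)
      moreover have "\<theta> (Suc n) \<omega> = \<theta> n \<omega> + \<delta> n \<omega>"
        using recursion[OF \<omega>, of n] by (simp add: \<delta>_def)
      ultimately show "\<psi> (\<theta> (Suc n) \<omega>) \<le>
          \<psi> (\<theta> n \<omega>) + a n * (w (\<theta> n \<omega>) \<bullet> M (Suc n) \<omega>) + C * (a n * K)\<^sup>2 * (X n \<omega>)\<^sup>2"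
        by simp
    qed
    then have "e (Suc n) \<le> (\<integral>\<omega>. \<psi> (\<theta> n \<omega>) + a n * (w (\<theta> n \<omega>) \<bullet> M (Suc n) \<omega>)
        + C * (a n * K)\<^sup>2 * (X n \<omega>)\<^sup>2 \<partial>P)"
      unfolding e_def using \<psi>_int wM(1) X_int by (intro integral_mono_AE) auto
    also have "\<dots> = e n + C * (a n * K)\<^sup>2 * (\<integral>\<omega>. (X n \<omega>)\<^sup>2 \<partial>P)"
      unfolding e_def using \<psi>_int wM X_int by simp
    also have "\<dots> \<le> e n + C * (a n * K)\<^sup>2 * (E n * q)"
      using EX[of n] \<open>0 < C\<close> by (intro add_left_mono mult_left_mono) auto
    finally show ?thesis by (simp add: b_def power_mult_distrib mult_ac)
  qed
  have "summable b"
    unfolding b_def E_def by (intro summable_mult summable_sq_steps_exp_sum[OF p(1) steps])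
  have "0 \<le> q" by (simp add: q_def)
  then have b_nonneg: "0 \<le> b n" for n using \<open>0 < C\<close> by (simp add: b_def E_def)
  \<comment> \<open>Summing from 0 instead of \<open>N\<close> only enlarges the bound, because
    \<open>b\<close> is nonnegative.\<close>
  have e_sum: "e n \<le> e N + (\<Sum>i<n. b i)" if "n \<ge> N" for n
    using that
  proof (induction n rule: dec_induct)
    case base
    show ?case using b_nonneg by (simp add: sum_nonneg)
  next
    case (step n)
    then show ?case using \<open>\<And>n. N \<le> n \<Longrightarrow> e (Suc n) \<le> e n + b n\<close>[of n] by simp
  qed
  \<comment> \<open>The absolute value of \<open>B\<close> keeps the majorant of \<phi> nonnegative,
    as the passage from \<open>ennreal\<close> integrals to real ones requires.\<close>
  define Z where "Z = e N + suminf b + \<bar>B\<bar>"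
  have "(\<integral>\<^sup>+ \<omega>. ennreal (\<phi> (\<theta> n \<omega>)) \<partial>P) \<le> ennreal Z" if "n \<ge> N" for n
  proof -
    have "(\<integral>\<^sup>+ \<omega>. ennreal (\<phi> (\<theta> n \<omega>)) \<partial>P) \<le> (\<integral>\<^sup>+ \<omega>. ennreal (\<psi> (\<theta> n \<omega>) + \<bar>B\<bar>) \<partial>P)"
      using \<psi>(2) by (intro nn_integral_mono ennreal_leI) (smt (verit))
    also have "\<dots> = ennreal (\<integral>\<omega>. \<psi> (\<theta> n \<omega>) + \<bar>B\<bar> \<partial>P)"
      using \<psi>_int \<psi>(1) by (intro nn_integral_eq_integral) auto
    also have "(\<integral>\<omega>. \<psi> (\<theta> n \<omega>) + \<bar>B\<bar> \<partial>P) = e n + \<bar>B\<bar>"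
      using \<psi>_int by (simp add: e_def prob_space)
    also have "ennreal (e n + \<bar>B\<bar>) \<le> ennreal Z"
      using e_sum[OF that] sum_le_suminf[OF \<open>summable b\<close>, of "{..<n}"] b_nonneg
      by (intro ennreal_leI) (simp add: Z_def)
    finally show ?thesis .
  qed
  then have "limsup (\<lambda>n. \<integral>\<^sup>+ \<omega>. ennreal (\<phi> (\<theta> n \<omega>)) \<partial>P) \<le> ennreal Z"
    by (intro Limsup_bounded) (auto simp: eventually_sequentially)
  then have "liminf (\<lambda>n. \<integral>\<^sup>+ \<omega>. ennreal (\<phi> (\<theta> n \<omega>)) \<partial>P) \<le> ennreal Z"
    using Liminf_le_Limsup[OF sequentially_bot] by (rule order_trans[rotated])
  then show ?thesis by (simp add: order_le_less_trans)
qed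

end
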